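(* Let $T>0$ and let $F$, $A$, $X_0$ satisfy the standing assumptions (i)-(iii) of the context, with Lipschitz constant $L$. For every integer $N\ge 1$ let $h_N:=T/N$, and let the blowup size be $\beta_N:=L(P+1)h_N^2$, where $P$ is the constant of the context (the relaxation parameter is $\delta_N=0$). Then for every $\tau\in(0,\tau^*]$ and every $x(\cdot)\in S^c(\tau)$ there exists a sequence $(y_N)_{N\ge1}$ with $y_N=(y_{N,n})_{n=0}^{\lfloor\tau/h_N\rfloor}\in S^c_N(\lfloor\tau/h_N\rfloor,\beta_N,0)$ such that $$x(t_{N,n})=y_{N,n},\qquad n=0,\ldots,\lfloor\tau/h_N\rfloor .$$
   Context: Notation: $\|\cdot\|$ is the Euclidean norm on $\mathbb{R}^d$; for a point $a$ and a set $B$, $\mathrm{dist}(a,B)=\inf_{b\in B}\|a-b\|$ (with $\mathrm{dist}(a,\emptyset)=+\infty$); for sets $A,B$, $\mathrm{dist}(A,B)=\sup_{a\in A}\mathrm{dist}(a,B)$; $B_\rho(0)$ is the closed ball of radius $\rho$; $\|F(0,x)\|:=\sup_{v\in F(0,x)}\|v\|$. $W^{1,1}([0,\tau],\mathbb{R}^d)$ is the space of absolutely continuous functions. Standing assumptions: (i) $F:[0,T]\times\mathbb{R}^d\rightrightarrows\mathbb{R}^d$ has nonempty, convex, compact values and there is $L>0$ with $\mathrm{dist}(F(t,x),F(t',x'))\le L|t-t'|+L\|x-x'\|$ for all $t,t'\in[0,T]$, $x,x'\in\mathbb{R}^d$. (ii) $A:[0,T]\rightrightarrows\mathbb{R}^d$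 has closed values, and $t_n\to t$, $x_n\in A(t_n)$, $x_n\to x$ imply $x\in A(t)$. (iii) $X_0\subset\mathbb{R}^d$ is compact, and there is $\tau\in(0,T]$ with $S^c(\tau)\ne\emptyset$. Exact solutions: for $\tau\in(0,T]$, $S^u(\tau)$ is the set of $x(\cdot)\in W^{1,1}([0,\tau],\mathbb{R}^d)$ with $\dot x(t)\in F(t,x(t))$ for a.e. $t\in(0,\tau)$ and $x(0)\in X_0$; $S^c(\tau)$ is the set of $x(\cdot)\in S^u(\tau)$ with $x(t)\in A(t)$ for all $t\in[0,\tau]$. Put $\tau^*:=\sup\{\tau\in(0,T]:S^c(\tau)\neq\emptyset\}$. Inflated Euler scheme: $h_N=T/N$, $t_{N,n}=nh_N$. For $\beta,\delta\ge0$ and $\nu\in\{0,\ldots,N\}$, $S^c_N(\nu,\beta,\delta)$ is the set of finite sequences $(y_{N,n})_{n=0}^\nu\subset\mathbb{R}^d$ with $y_{N,n+1}\in y_{N,n}+h_NF(t_{N,n},y_{N,n})+B_{\beta}(0)$ for $0\le n\le\nu-1$, $\mathrm{dist}(y_{N,0},X_0)\le\delta$, and $\mathrm{dist}(y_{N,n},A(t_{N,n}))\le\delta$ for $0\le n\le\nu$. The constants: with blowup sizes $\beta_N\ge0$, $\beta_N/h_N\to0$, and relaxation parameters $\delta_N=0$, $$R:=\max\{1,\tfrac1L\}\,e^{LT}\Big(\sup_{x\in X_0}\|F(0,x)\|+\sup_{N\ge1}\big(\delta_N+\tfrac{\beta_N}{Lh_N}\big)+1\Big)<\infty,\qquad P:=L(T+R)+\sup_{x\in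 X_0}\|F(0,x)\|.$$ The relations defining $\beta_N$, $R$ and $P$ are understood to hold simultaneously. *)

theory Defs
  imports "HOL-Analysis.Analysis"
begin

text \<open>
  Distances take values in \<^typ>\<open>ennreal\<close>, so that the infimum over the empty set is \<open>\<infinity>\<close>;
  \<^const>\<open>infdist\<close> and \<^const>\<open>setdist\<close> would give \<open>0\<close> there.
  \<open>excess\<close> is the one-sided (asymmetric) Hausdorff distance.
\<close>

definition point_dist :: "'a::real_normed_vector \<Rightarrow> 'a set \<Rightarrow> ennreal" where
  "point_dist a B = (INF b\<in>B. ennreal (norm (a - b)))"

definition excess :: "'a::real_normed_vector set \<Rightarrow> 'a set \<Rightarrow> ennreal" where
  "excess A B = (SUP a\<in>A. point_dist a B)"

text \<open>
  The epsilon-delta definition; finite families of non-overlapping subintervals are given as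
  divisions of their union. Only the values of \<open>f\<close> on \<open>{a..b}\<close> matter.
\<close>

definition abs_continuous_on :: "real \<Rightarrow> real \<Rightarrow> (real \<Rightarrow> 'a::real_normed_vector) \<Rightarrow> bool" where
  "abs_continuous_on a b f \<longleftrightarrow>
    (\<forall>\<epsilon>>0. \<exists>\<delta>>0. \<forall>D. D division_of \<Union>D \<and> \<Union>D \<subseteq> {a..b} \<and> (\<Sum>K\<in>D. measure lborel K) < \<delta>
        \<longrightarrow> (\<Sum>K\<in>D. norm (f (Sup K) - f (Inf K))) < \<epsilon>)"

text \<open>
  Functions on \<open>[0,\<tau>]\<close> are represented by functions on \<^typ>\<open>real\<close> whose values outside
  \<open>[0,\<tau>]\<close> are irrelevant. The derivative is required to exist almost everywhere; this is
  automatic for absolutely continuous functions but has to be stated because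
  \<^const>\<open>vector_derivative\<close> is total.
\<close>

definition sols_unconstrained ::
  "(real \<Rightarrow> 'a::euclidean_space \<Rightarrow> 'a set) \<Rightarrow> 'a set \<Rightarrow> real \<Rightarrow> (real \<Rightarrow> 'a) set" where
  "sols_unconstrained F X0 \<tau> =
    {x. abs_continuous_on 0 \<tau> x
      \<and> (AE t in lebesgue. t \<in> {0<..<\<tau>} \<longrightarrow>
            x differentiable (at t) \<and> vector_derivative x (at t) \<in> F t (x t))
      \<and> x 0 \<in> X0}"

definition sols_constrained ::
  "(real \<Rightarrow> 'a::euclidean_space \<Rightarrow> 'a set) \<Rightarrow> (real \<Rightarrow> 'a set) \<Rightarrow> 'a set \<Rightarrow> real \<Rightarrow> (real \<Rightarrow> 'a) set" where
  "sols_constrained F A X0 \<tau> = {x \<in> sols_unconstrained F X0 \<tau>. \<forall>t\<in>{0..\<tau>}. x t \<in> A t}"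

definition max_time ::
  "real \<Rightarrow> (real \<Rightarrow> 'a::euclidean_space \<Rightarrow> 'a set) \<Rightarrow> (real \<Rightarrow> 'a set) \<Rightarrow> 'a set \<Rightarrow> real" where
  "max_time T F A X0 = Sup {\<tau> \<in> {0<..T}. sols_constrained F A X0 \<tau> \<noteq> {}}"

definition step_size :: "real \<Rightarrow> nat \<Rightarrow> real" where
  "step_size T N = T / real N"

definition grid :: "real \<Rightarrow> nat \<Rightarrow> nat \<Rightarrow> real" where
  "grid T N n = real n * step_size T N"

text \<open>
  A finite sequence \<open>(y\<^sub>0, \<dots>, y\<^sub>\<nu>)\<close> is represented by a function on \<^typ>\<open>nat\<close> whose values beyond
  \<open>\<nu>\<close> are irrelevant. The inclusion is in the Minkowski sum
  \<open>y n + h F(t\<^sub>n, y n) + B\<^sub>\<beta>(0)\<close>.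
\<close>

definition euler_sols ::
  "real \<Rightarrow> (real \<Rightarrow> 'a::euclidean_space \<Rightarrow> 'a set) \<Rightarrow> (real \<Rightarrow> 'a set) \<Rightarrow> 'a set
    \<Rightarrow> nat \<Rightarrow> nat \<Rightarrow> real \<Rightarrow> real \<Rightarrow> (nat \<Rightarrow> 'a) set" where
  "euler_sols T F A X0 N \<nu> \<beta> \<delta> =
    {y. (\<forall>n<\<nu>. y (Suc n) \<in>
            {y n + step_size T N *\<^sub>R v + b | v b. v \<in> F (grid T N n) (y n) \<and> b \<in> cball 0 \<beta>})
      \<and> point_dist (y 0) X0 \<le> ennreal \<delta>
      \<and> (\<forall>n\<le>\<nu>. point_dist (y n) (A (grid T N n)) \<le> ennreal \<delta>)}"

text \<open>
  The constants \<open>R\<close> and \<open>P\<close>. The suprema are over nonempty sets of reals; they are bounded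
  when \<open>X0\<close> is compact, \<open>F\<close> is Lipschitz with compact values, and \<open>\<delta> N\<close> and
  \<open>\<beta> N / step_size T N\<close> are bounded.
\<close>

definition init_speed ::
  "(real \<Rightarrow> 'a::real_normed_vector \<Rightarrow> 'a set) \<Rightarrow> 'a set \<Rightarrow> real" where
  "init_speed F X0 = (SUP x\<in>X0. SUP v\<in>F 0 x. norm v)"

definition R_const ::
  "real \<Rightarrow> real \<Rightarrow> (real \<Rightarrow> 'a::real_normed_vector \<Rightarrow> 'a set) \<Rightarrow> 'a set
    \<Rightarrow> (nat \<Rightarrow> real) \<Rightarrow> (nat \<Rightarrow> real) \<Rightarrow> real" where
  "R_const T L F X0 \<beta> \<delta> =
    max 1 (1 / L) * exp (L * T)
      * (init_speed F X0 + (SUP N\<in>{1..}. \<delta> N + \<beta> N / (L * step_size T N)) + 1)"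

definition P_const ::
  "real \<Rightarrow> real \<Rightarrow> (real \<Rightarrow> 'a::real_normed_vector \<Rightarrow> 'a set) \<Rightarrow> 'a set \<Rightarrow> real \<Rightarrow> real" where
  "P_const T L F X0 R = L * (T + R) + init_speed F X0"

end

(*
  The sequence is y_n = x(t_n), so only the one-step inclusion needs proof. Gronwall's inequality
  bounds the trajectory by R around x(0), hence its speed by P. On [t_n, t_n + h] the derivative
  therefore lies a.e. in the closed convex set F(t_n, x(t_n)) + B_r(0) with r = L (P + 1) h, and so
  does the average slope. Multiplying by h gives the blowup beta_N = L (P + 1) h^2.

  No integration is used. All mean value estimates reduce to the monotonicity of an absolutely
  continuous real function with nonpositive derivative a.e.: the exceptional null set is covered
  by an open set of small measure, where absolute continuity controls the increments, and a
  gauge-fine tagged division combines this with the local estimates at the remaining points.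
*)
theory Submission
  imports Defs
begin

section \<open>Absolutely continuous functions on an interval\<close>

lemma abs_continuous_onE:
  assumes "abs_continuous_on a b f" "\<epsilon> > 0"
  obtains \<delta> where "\<delta> > 0"
    "\<And>D. D division_of \<Union>D \<Longrightarrow> \<Union>D \<subseteq> {a..b} \<Longrightarrow> (\<Sum>K\<in>D. measure lborel K) < \<delta> \<Longrightarrow>
       (\<Sum>K\<in>D. norm (f (Sup K) - f (Inf K))) < \<epsilon>"
  using assms unfolding abs_continuous_on_def by metis

lemma abs_continuous_on_subset:
  assumes "abs_continuous_on a b f" "{c..d} \<subseteq> {a..b}"
  shows "abs_continuous_on c d f"
  unfolding abs_continuous_on_def
proof (intro allI impI)
  fix \<epsilon> :: real assume "\<epsilon> > 0"
  then obtain \<delta> where "\<delta> > 0" and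
    "\<And>D. D division_of \<Union>D \<Longrightarrow> \<Union>D \<subseteq> {a..b} \<Longrightarrow> (\<Sum>K\<in>D. measure lborel K) < \<delta> \<Longrightarrow>
       (\<Sum>K\<in>D. norm (f (Sup K) - f (Inf K))) < \<epsilon>"
    using abs_continuous_onE[OF assms(1)] by blast
  then show "\<exists>\<delta>>0. \<forall>D. D division_of \<Union>D \<and> \<Union>D \<subseteq> {c..d} \<and> (\<Sum>K\<in>D. measure lborel K) < \<delta>
      \<longrightarrow> (\<Sum>K\<in>D. norm (f (Sup K) - f (Inf K))) < \<epsilon>"
    using assms(2) by (meson order_trans)
qed

lemma abs_continuous_on_imp_continuous_on:
  assumes "abs_continuous_on a b f"
  shows "continuous_on {a..b} f"
  unfolding continuous_on_iff
proof (intro ballI allI impI)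
  fix s \<epsilon> :: real assume s: "s \<in> {a..b}" and "\<epsilon> > 0"
  then obtain \<delta> where "\<delta> > 0" and
    \<delta>: "\<And>D. D division_of \<Union>D \<Longrightarrow> \<Union>D \<subseteq> {a..b} \<Longrightarrow> (\<Sum>K\<in>D. measure lborel K) < \<delta> \<Longrightarrow>
       (\<Sum>K\<in>D. norm (f (Sup K) - f (Inf K))) < \<epsilon>"
    using abs_continuous_onE[OF assms] by blast
  have small: "norm (f v - f u) < \<epsilon>" if "a \<le> u" "u \<le> v" "v \<le> b" "v - u < \<delta>" for u v
  proof -
    have "{{u..v}} division_of {u..v}"
      using division_of_self[of u v] that by simp
    then show ?thesis
      using \<delta>[of "{{u..v}}"] that by simp
  qed
  have "dist (f t) (f s) < \<epsilon>" if "t \<in> {a..b}" "dist t s < \<delta>" for t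
    using that s small[of s t] small[of t s] norm_minus_commute[of "f t" "f s"]
    by (cases "t \<le> s") (auto simp: dist_norm)
  then show "\<exists>d>0. \<forall>t\<in>{a..b}. dist t s < d \<longrightarrow> dist (f t) (f s) < \<epsilon>"
    using \<open>\<delta> > 0\<close> by blast
qed

lemma division_of_real_Sup_Inf:
  fixes K :: "real set"
  assumes "D division_of S" "K \<in> D"
  shows "Inf K \<le> Sup K" "K = {Inf K..Sup K}" "measure lborel K = Sup K - Inf K"
proof -
  obtain u v where "K = {u..v}" "u \<le> v"
    using division_ofD(3,4)[OF assms] by (metis atLeastatMost_empty_iff2 box_real(2))
  then show "Inf K \<le> Sup K" "K = {Inf K..Sup K}" "measure lborel K = Sup K - Inf K"
    by auto
qed

text \<open>Makes comparison functions \<open>\<phi>\<close> available: they enter the estimates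
  below through \<open>f - \<phi>\<close> and are only required to be Lipschitz. The threshold
  \<open>\<epsilon> / (C + 1)\<close> stays meaningful for \<open>C = 0\<close> and leaves room for
  the strict inequality.\<close>

lemma lipschitz_on_imp_abs_continuous_on:
  fixes f :: "real \<Rightarrow> 'a::real_normed_vector"
  assumes "C-lipschitz_on {a..b} f"
  shows "abs_continuous_on a b f"
  unfolding abs_continuous_on_def
proof (intro allI impI)
  fix \<epsilon> :: real assume "\<epsilon> > 0"
  have "C \<ge> 0"
    using assms lipschitz_on_nonneg by blast
  have "(\<Sum>K\<in>D. norm (f (Sup K) - f (Inf K))) < \<epsilon>"
    if "D division_of \<Union>D" "\<Union>D \<subseteq> {a..b}" "(\<Sum>K\<in>D. measure lborel K) < \<epsilon> / (C + 1)" for D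
  proof -
    have "norm (f (Sup K) - f (Inf K)) \<le> C * measure lborel K" if "K \<in> D" for K
    proof -
      note K = division_of_real_Sup_Inf[OF \<open>D division_of \<Union>D\<close> that]
      then have "Sup K \<in> K" "Inf K \<in> K"
        by (metis atLeastAtMost_iff order_refl)+
      then have "Sup K \<in> {a..b}" "Inf K \<in> {a..b}"
        using that \<open>\<Union>D \<subseteq> {a..b}\<close> by blast+
      from lipschitz_on_normD[OF assms this] K(1,3) show ?thesis
        by simp
    qed
    then have "(\<Sum>K\<in>D. norm (f (Sup K) - f (Inf K))) \<le> C * (\<Sum>K\<in>D. measure lborel K)"
      by (simp add: sum_distrib_left sum_mono)
    also have "\<dots> \<le> C * (\<epsilon> / (C + 1))"
      using that(3) \<open>C \<ge> 0\<close> by (intro mult_left_mono) auto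
    also have "\<dots> < \<epsilon>"
      using \<open>\<epsilon> > 0\<close> \<open>C \<ge> 0\<close> by (simp add: field_simps)
    finally show ?thesis .
  qed
  then show "\<exists>\<delta>>0. \<forall>D. D division_of \<Union>D \<and> \<Union>D \<subseteq> {a..b} \<and> (\<Sum>K\<in>D. measure lborel K) < \<delta>
      \<longrightarrow> (\<Sum>K\<in>D. norm (f (Sup K) - f (Inf K))) < \<epsilon>"
    using \<open>\<epsilon> > 0\<close> \<open>C \<ge> 0\<close> by (intro exI[of _ "\<epsilon> / (C + 1)"]) auto
qed

lemma abs_continuous_on_diff:
  assumes "abs_continuous_on a b f" "abs_continuous_on a b g"
  shows "abs_continuous_on a b (\<lambda>t. f t - g t)"
  unfolding abs_continuous_on_def
proof (intro allI impI)
  fix \<epsilon> :: real assume "\<epsilon> > 0"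
  then have "\<epsilon> / 2 > 0" by simp
  obtain \<delta> where "\<delta> > 0" and
    \<delta>: "\<And>D. D division_of \<Union>D \<Longrightarrow> \<Union>D \<subseteq> {a..b} \<Longrightarrow> (\<Sum>K\<in>D. measure lborel K) < \<delta> \<Longrightarrow>
       (\<Sum>K\<in>D. norm (f (Sup K) - f (Inf K))) < \<epsilon> / 2"
    using abs_continuous_onE[OF assms(1) \<open>\<epsilon> / 2 > 0\<close>] by blast
  obtain \<eta> where "\<eta> > 0" and
    \<eta>: "\<And>D. D division_of \<Union>D \<Longrightarrow> \<Union>D \<subseteq> {a..b} \<Longrightarrow> (\<Sum>K\<in>D. measure lborel K) < \<eta> \<Longrightarrow>
       (\<Sum>K\<in>D. norm (g (Sup K) - g (Inf K))) < \<epsilon> / 2"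
    using abs_continuous_onE[OF assms(2) \<open>\<epsilon> / 2 > 0\<close>] by blast
  have "(\<Sum>K\<in>D. norm (f (Sup K) - g (Sup K) - (f (Inf K) - g (Inf K)))) < \<epsilon>"
    if "D division_of \<Union>D" "\<Union>D \<subseteq> {a..b}" "(\<Sum>K\<in>D. measure lborel K) < min \<delta> \<eta>" for D
  proof -
    have "(\<Sum>K\<in>D. norm (f (Sup K) - g (Sup K) - (f (Inf K) - g (Inf K))))
        \<le> (\<Sum>K\<in>D. norm (f (Sup K) - f (Inf K)) + norm (g (Sup K) - g (Inf K)))"
    proof (rule sum_mono)
      fix K
      show "norm (f (Sup K) - g (Sup K) - (f (Inf K) - g (Inf K)))
          \<le> norm (f (Sup K) - f (Inf K)) + norm (g (Sup K) - g (Inf K))"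
        using norm_triangle_ineq4[of "f (Sup K) - f (Inf K)" "g (Sup K) - g (Inf K)"]
        by (simp add: algebra_simps)
    qed
    also have "\<dots> < \<epsilon>"
      using \<delta>[of D] \<eta>[of D] that by (simp add: sum.distrib)
    finally show ?thesis .
  qed
  then show "\<exists>\<delta>>0. \<forall>D. D division_of \<Union>D \<and> \<Union>D \<subseteq> {a..b} \<and> (\<Sum>K\<in>D. measure lborel K) < \<delta>
      \<longrightarrow> (\<Sum>K\<in>D. norm (f (Sup K) - g (Sup K) - (f (Inf K) - g (Inf K)))) < \<epsilon>"
    using \<open>\<delta> > 0\<close> \<open>\<eta> > 0\<close> by (intro exI[of _ "min \<delta> \<eta>"]) auto
qed

text \<open>Cauchy-Schwarz costs a factor \<open>norm w\<close>. This passes from vector-valued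
  curves to real functions, where monotonicity arguments apply.\<close>

lemma abs_continuous_on_inner:
  fixes f :: "real \<Rightarrow> 'a::real_inner"
  assumes "abs_continuous_on a b f"
  shows "abs_continuous_on a b (\<lambda>t. w \<bullet> f t)"
  unfolding abs_continuous_on_def
proof (intro allI impI)
  fix \<epsilon> :: real assume "\<epsilon> > 0"
  then have "\<epsilon> / (norm w + 1) > 0"
    by (simp add: add_nonneg_pos)
  from abs_continuous_onE[OF assms this] obtain \<delta> where "\<delta> > 0" and
    \<delta>: "\<And>D. D division_of \<Union>D \<Longrightarrow> \<Union>D \<subseteq> {a..b} \<Longrightarrow> (\<Sum>K\<in>D. measure lborel K) < \<delta> \<Longrightarrow>
       (\<Sum>K\<in>D. norm (f (Sup K) - f (Inf K))) < \<epsilon> / (norm w + 1)"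
    by blast
  have "(\<Sum>K\<in>D. norm (w \<bullet> f (Sup K) - w \<bullet> f (Inf K))) < \<epsilon>"
    if "D division_of \<Union>D" "\<Union>D \<subseteq> {a..b}" "(\<Sum>K\<in>D. measure lborel K) < \<delta>" for D
  proof -
    have "(\<Sum>K\<in>D. norm (w \<bullet> f (Sup K) - w \<bullet> f (Inf K)))
        \<le> norm w * (\<Sum>K\<in>D. norm (f (Sup K) - f (Inf K)))"
      by (simp add: sum_distrib_left sum_mono Cauchy_Schwarz_ineq2 flip: inner_diff_right)
    also have "\<dots> \<le> norm w * (\<epsilon> / (norm w + 1))"
      using \<delta>[OF that] by (intro mult_left_mono) auto
    also have "\<dots> < \<epsilon>"
      using \<open>\<epsilon> > 0\<close> by (simp add: add_nonneg_pos pos_divide_less_eq distrib_left mult.commute)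
    finally show ?thesis .
  qed
  then show "\<exists>\<delta>>0. \<forall>D. D division_of \<Union>D \<and> \<Union>D \<subseteq> {a..b} \<and> (\<Sum>K\<in>D. measure lborel K) < \<delta>
      \<longrightarrow> (\<Sum>K\<in>D. norm (w \<bullet> f (Sup K) - w \<bullet> f (Inf K))) < \<epsilon>"
    using \<open>\<delta> > 0\<close> by blast
qed

section \<open>Monotonicity from an almost everywhere nonpositive derivative\<close>

text \<open>Two distinct elements of a division meet in a convex set with empty interior, hence in a
  negligible set, so their measures add up to that of the union.\<close>

lemma sum_measure_division_le:
  fixes D :: "'a::euclidean_space set set"
  assumes "D division_of S" "S \<subseteq> U" "U \<in> lmeasurable"
  shows "(\<Sum>K\<in>D. measure lborel K) \<le> measure lebesgue U"
proof -
  have meas: "K \<in> lmeasurable" if "K \<in> D" for K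
    using division_ofD(4)[OF assms(1) that] by auto
  have neg: "negligible (K \<inter> K')" if "K \<in> D" "K' \<in> D" "K \<noteq> K'" for K K'
  proof -
    have "convex (K \<inter> K')"
      using division_ofD(4)[OF assms(1)] that by (metis convex_Int convex_box(1))
    moreover have "interior (K \<inter> K') = {}"
      using division_ofD(5)[OF assms(1)] that by simp
    ultimately show ?thesis
      using negligible_convex_interior by blast
  qed
  have "measure lborel K = measure lebesgue K" if "K \<in> D" for K
    using division_ofD(4)[OF assms(1) that] by (auto simp: measure_completion)
  then have "(\<Sum>K\<in>D. measure lborel K) = (\<Sum>K\<in>D. measure lebesgue K)"
    by simp
  also have "\<dots> = measure lebesgue (\<Union>D)"
    using meas neg division_ofD(1)[OF assms(1)]
    by (intro measure_negligible_finite_Union[symmetric]) (auto simp: pairwise_def)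
  also have "\<dots> \<le> measure lebesgue U"
    using assms division_ofD(1,6)[OF assms(1)] meas
    by (intro measure_mono_fmeasurable) (auto intro: fmeasurableD)
  finally show ?thesis .
qed

text \<open>Because \<open>u\<close> and \<open>v\<close> lie on opposite sides of \<open>t\<close>,
  the linearization errors \<open>\<epsilon> * (t - u)\<close> and
  \<open>\<epsilon> * (v - t)\<close> add up exactly to \<open>\<epsilon> * (v - u)\<close>, while
  both linear terms have the favourable sign.\<close>

lemma has_real_derivative_nonpos_straddle:
  fixes g :: "real \<Rightarrow> real"
  assumes "(g has_real_derivative D) (at t)" "D \<le> 0" "\<epsilon> > 0"
  obtains r where "r > 0"
    "\<And>u v. u \<le> t \<Longrightarrow> t \<le> v \<Longrightarrow> u \<in> ball t r \<Longrightarrow> v \<in> ball t r \<Longrightarrow> g v - g u \<le> \<epsilon> * (v - u)"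
proof -
  obtain r where "r > 0" and
    r: "\<And>y. \<bar>y - t\<bar> < r \<Longrightarrow> \<bar>g y - g t - D * (y - t)\<bar> \<le> \<epsilon> * \<bar>y - t\<bar>"
    using assms(1,3) unfolding has_field_derivative_def has_derivative_at_alt by auto
  have "g v - g u \<le> \<epsilon> * (v - u)"
    if "u \<le> t" "t \<le> v" "u \<in> ball t r" "v \<in> ball t r" for u v
  proof -
    have "D * (v - t) \<le> 0" "D * (u - t) \<ge> 0"
      using that \<open>D \<le> 0\<close> by (auto simp: mult_nonpos_nonneg mult_nonpos_nonpos)
    then show ?thesis
      using r[of v] r[of u] that by (auto simp: dist_real_def algebra_simps)
  qed
  then show ?thesis
    using that \<open>r > 0\<close> by blast
qed

lemma abs_continuous_on_nonincreasing:
  fixes g :: "real \<Rightarrow> real"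
  assumes ac: "abs_continuous_on a b g" and "a \<le> b"
    and der: "AE t in lebesgue. t \<in> {a<..<b} \<longrightarrow> (\<exists>D\<le>0. (g has_real_derivative D) (at t))"
  shows "g b \<le> g a"
proof (rule field_le_epsilon)
  fix e :: real assume "e > 0"
  \<comment> \<open>The budget \<open>e\<close> is split in two: intervals with exceptional tags
    contribute at most \<open>\<epsilon>\<close> in total, all others at most
    \<open>\<epsilon> * (b - a)\<close>.\<close>
  define \<epsilon> where "\<epsilon> = e / (1 + (b - a))"
  have "1 + (b - a) > 0"
    using \<open>a \<le> b\<close> by simp
  then have "\<epsilon> > 0" and "\<epsilon> * (1 + (b - a)) = e"
    using \<open>e > 0\<close> by (simp_all add: \<epsilon>_def)
  then have e: "\<epsilon> + \<epsilon> * (b - a) = e"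
    by (simp add: distrib_left)
  obtain N where N: "N \<in> null_sets lebesgue"
    "{t. \<not> (t \<in> {a<..<b} \<longrightarrow> (\<exists>D\<le>0. (g has_real_derivative D) (at t)))} \<subseteq> N"
    using der by (auto simp: eventually_ae_filter)
  \<comment> \<open>The endpoints count as exceptional, since \<open>der\<close> says nothing there
    and a tag may be an endpoint.\<close>
  define E where "E = N \<union> {t. t \<notin> {a<..<b} \<and> t \<in> {a..b}}"
  have "{t. t \<notin> {a<..<b} \<and> t \<in> {a..b}} \<subseteq> {a, b}"
    by auto
  then have "negligible {t. t \<notin> {a<..<b} \<and> t \<in> {a..b}}"
    by (meson finite.emptyI finite_insert negligible_finite negligible_subset)
  then have "negligible E"
    using N(1) by (simp add: E_def negligible_iff_null_sets null_sets.Un)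
  have good: "\<exists>D\<le>0. (g has_real_derivative D) (at t)" if "t \<notin> E" "t \<in> {a..b}" for t
    using that N(2) unfolding E_def by blast
  obtain \<delta> where "\<delta> > 0" and
    \<delta>: "\<And>D. D division_of \<Union>D \<Longrightarrow> \<Union>D \<subseteq> {a..b} \<Longrightarrow> (\<Sum>K\<in>D. measure lborel K) < \<delta> \<Longrightarrow>
       (\<Sum>K\<in>D. norm (g (Sup K) - g (Inf K))) < \<epsilon>"
    using abs_continuous_onE[OF ac \<open>\<epsilon> > 0\<close>] by blast
  obtain U where U: "open U" "E \<subseteq> U" "U - E \<in> lmeasurable"
      "emeasure lebesgue (U - E) < ennreal \<delta>"
    using sets_lebesgue_outer_open[OF negligible_imp_sets[OF \<open>negligible E\<close>] \<open>\<delta> > 0\<close>] by metis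
  \<comment> \<open>Outer approximation controls only \<open>U - E\<close>; adding the negligible
    set \<open>E\<close> back does not change the measure.\<close>
  have U_eq: "(U - E) \<union> E = U"
    using U(2) by blast
  have U_meas: "U \<in> lmeasurable"
    using fmeasurable.Un[OF U(3) negligible_imp_measurable[OF \<open>negligible E\<close>]] unfolding U_eq .
  have "measure lebesgue U = measure lebesgue (U - E)"
    using measure_Un_null_set[OF fmeasurableD[OF U(3)], of E] \<open>negligible E\<close>
    unfolding U_eq negligible_iff_null_sets by blast
  then have U_small: "measure lebesgue U < \<delta>"
    using U(3,4) \<open>\<delta> > 0\<close> by (simp add: emeasure_eq_measure2 ennreal_less_iff)
  \<comment> \<open>The restrictions on \<open>t\<close> stand inside the existential so that choice
    yields a radius that is positive at every real \<open>t\<close>, as a gauge demands.\<close>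
  have "\<exists>r>0. t \<notin> E \<longrightarrow> t \<in> {a..b} \<longrightarrow> (\<forall>u v. u \<le> t \<longrightarrow> t \<le> v \<longrightarrow> u \<in> ball t r \<longrightarrow> v \<in> ball t r \<longrightarrow>
      g v - g u \<le> \<epsilon> * (v - u))" for t
  proof (cases "t \<notin> E \<and> t \<in> {a..b}")
    case True
    then obtain D where "D \<le> 0" "(g has_real_derivative D) (at t)"
      using good by blast
    then obtain r where "r > 0"
      "\<And>u v. u \<le> t \<Longrightarrow> t \<le> v \<Longrightarrow> u \<in> ball t r \<Longrightarrow> v \<in> ball t r \<Longrightarrow> g v - g u \<le> \<epsilon> * (v - u)"
      using has_real_derivative_nonpos_straddle[OF _ _ \<open>\<epsilon> > 0\<close>] by blast
    then show ?thesis
      by blast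
  next
    case False
    then show ?thesis
      using zero_less_one by blast
  qed
  then obtain r where r: "\<And>t. r t > 0" "\<And>t u v. t \<notin> E \<Longrightarrow> t \<in> {a..b} \<Longrightarrow> u \<le> t \<Longrightarrow> t \<le> v \<Longrightarrow>
      u \<in> ball t (r t) \<Longrightarrow> v \<in> ball t (r t) \<Longrightarrow> g v - g u \<le> \<epsilon> * (v - u)"
    by metis
  \<comment> \<open>An interval with an exceptional tag is forced into the small set
    \<open>U\<close>; one with a good tag is forced into the ball where the straddle estimate
    holds.\<close>
  define \<gamma> where "\<gamma> t = (if t \<in> E then U else ball t (r t))" for t
  have "gauge \<gamma>"
    using U r(1) by (auto simp: gauge_def \<gamma>_def)
  then obtain p where p: "p tagged_division_of {a..b}" "\<gamma> fine p"
    using fine_division_exists_real by blast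
  have fin: "finite p"
    using p(1) by blast
  define B where "B = {(t, K) \<in> p. t \<in> E}"
  have "B \<subseteq> p"
    by (auto simp: B_def)
  have interval: "K = {Inf K..Sup K}" "t \<in> K" "Inf K \<le> Sup K" "K \<subseteq> {a..b}" "K \<subseteq> \<gamma> t"
    if tK: "(t, K) \<in> p" for t K
  proof -
    have "K \<in> snd ` p"
      using tK by force
    from division_of_real_Sup_Inf[OF division_of_tagged_division[OF p(1)] this]
    show "Inf K \<le> Sup K" "K = {Inf K..Sup K}"
      by blast+
    show "t \<in> K" "K \<subseteq> {a..b}" "K \<subseteq> \<gamma> t"
      using tagged_division_ofD(2,3)[OF p(1) tK] fineD[OF p(2) tK] by blast+
  qed
  have partB: "B tagged_partial_division_of {a..b}"
    using tagged_partial_division_subset[OF _ \<open>B \<subseteq> p\<close>] p(1) unfolding tagged_division_of_def by simp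
  note divB = partial_division_of_tagged_division[OF partB]
    and tagB = tagged_partial_division_of_Union_self[OF partB]
  have "K \<subseteq> U" "K \<subseteq> {a..b}" if "K \<in> snd ` B" for K
  proof -
    obtain t where t: "(t, K) \<in> p" "t \<in> E"
      using \<open>K \<in> snd ` B\<close> by (auto simp: B_def)
    show "K \<subseteq> U" "K \<subseteq> {a..b}"
      using interval(4,5)[OF t(1)] t(2) by (simp_all add: \<gamma>_def)
  qed
  then have subU: "\<Union>(snd ` B) \<subseteq> U" and subab: "\<Union>(snd ` B) \<subseteq> {a..b}"
    by blast+
  have "(\<Sum>K\<in>snd ` B. measure lborel K) < \<delta>"
    using sum_measure_division_le[OF divB subU U_meas] U_small by simp
  then have "(\<Sum>K\<in>snd ` B. norm (g (Sup K) - g (Inf K))) < \<epsilon>"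
    using \<delta>[OF divB subab] by blast
  \<comment> \<open>Passing from a sum over tagged intervals to a sum over intervals requires a
    summand that vanishes on every \<open>cbox\<close> with empty interior. This includes the empty
    set, where \<open>Sup\<close> and \<open>Inf\<close> carry no information, hence the explicit
    value 0.\<close>
  define d where "d K = (if K = {} then 0 else norm (g (Sup K) - g (Inf K)))" for K
  have "(\<Sum>(t, K)\<in>B. g (Sup K) - g (Inf K)) \<le> (\<Sum>(t, K)\<in>B. d K)"
  proof (rule sum_mono, clarify)
    fix t K assume "(t, K) \<in> B"
    then have "K \<noteq> {}"
      using interval(2) \<open>B \<subseteq> p\<close> by blast
    then show "g (Sup K) - g (Inf K) \<le> d K"
      by (simp add: d_def)
  qed
  also have "\<dots> = (\<Sum>K\<in>snd ` B. d K)"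
  proof (rule sum.over_tagged_division_lemma[OF tagB])
    fix u v :: real assume "box u v = {}"
    then show "d (cbox u v) = 0"
      by (cases "u = v") (auto simp: d_def)
  qed
  also have "\<dots> \<le> (\<Sum>K\<in>snd ` B. norm (g (Sup K) - g (Inf K)))"
    by (intro sum_mono) (simp add: d_def)
  also have "\<dots> < \<epsilon>"
    by fact
  finally have bad_part: "(\<Sum>(t, K)\<in>B. g (Sup K) - g (Inf K)) \<le> \<epsilon>"
    by simp
  have "(\<Sum>(t, K)\<in>p - B. g (Sup K) - g (Inf K)) \<le> (\<Sum>(t, K)\<in>p - B. \<epsilon> * (Sup K - Inf K))"
  proof (rule sum_mono, clarify)
    fix t K assume tK: "(t, K) \<in> p" "(t, K) \<notin> B"
    note K = interval[OF tK(1)]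
    have "t \<notin> E"
      using tK by (simp add: B_def)
    have "x \<in> K \<longleftrightarrow> Inf K \<le> x \<and> x \<le> Sup K" for x
      by (subst K(1)) simp
    then have "Inf K \<in> K" "Sup K \<in> K" "Inf K \<le> t" "t \<le> Sup K"
      using K(2,3) by simp_all
    then show "g (Sup K) - g (Inf K) \<le> \<epsilon> * (Sup K - Inf K)"
      using K(2,4,5) \<open>t \<notin> E\<close> unfolding \<gamma>_def by (intro r(2)[of t]) auto
  qed
  also have "\<dots> \<le> (\<Sum>(t, K)\<in>p. \<epsilon> * (Sup K - Inf K))"
    using fin interval(3) \<open>\<epsilon> > 0\<close> by (intro sum_mono2) auto
  also have "\<dots> = \<epsilon> * (\<Sum>(t, K)\<in>p. Sup K - Inf K)"
    by (simp add: sum_distrib_left split_def)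
  also have "\<dots> = \<epsilon> * (b - a)"
    using additive_tagged_division_1[OF \<open>a \<le> b\<close> p(1), of "\<lambda>t. t"] by simp
  finally have good_part: "(\<Sum>(t, K)\<in>p - B. g (Sup K) - g (Inf K)) \<le> \<epsilon> * (b - a)" .
  have "g b - g a = (\<Sum>(t, K)\<in>p. g (Sup K) - g (Inf K))"
    using additive_tagged_division_1[OF \<open>a \<le> b\<close> p(1), of g] by simp
  also have "\<dots> = (\<Sum>(t, K)\<in>p - B. g (Sup K) - g (Inf K)) + (\<Sum>(t, K)\<in>B. g (Sup K) - g (Inf K))"
    using sum.subset_diff[OF \<open>B \<subseteq> p\<close> fin] .
  also have "\<dots> \<le> e"
    using bad_part good_part e by simp
  finally show "g b \<le> g a + e"
    by simp
qed

section \<open>Mean value estimates for absolutely continuous curves\<close>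

text \<open>The real function \<open>w \<bullet> f t - \<phi> t\<close> is absolutely continuous
  with nonpositive derivative a.e., hence does not increase. Testing against a fixed
  \<open>w\<close> serves both the norm bound and the separation argument that follow.\<close>

lemma abs_continuous_on_inner_increment_le:
  fixes f :: "real \<Rightarrow> 'a::real_inner"
  assumes ac: "abs_continuous_on a b f" and "a \<le> b"
    and lip: "C-lipschitz_on {a..b} \<phi>"
    and \<phi>: "\<And>t. t \<in> {a<..<b} \<Longrightarrow> (\<phi> has_real_derivative \<phi>' t) (at t)"
    and der: "AE t in lebesgue. t \<in> {a<..<b} \<longrightarrow>
      f differentiable (at t) \<and> w \<bullet> vector_derivative f (at t) \<le> \<phi>' t"
  shows "w \<bullet> (f b - f a) \<le> \<phi> b - \<phi> a"
proof -
  have "abs_continuous_on a b (\<lambda>t. w \<bullet> f t - \<phi> t)"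
    by (intro abs_continuous_on_diff abs_continuous_on_inner[OF ac]
        lipschitz_on_imp_abs_continuous_on[OF lip])
  moreover have "AE t in lebesgue. t \<in> {a<..<b} \<longrightarrow>
      (\<exists>D\<le>0. ((\<lambda>t. w \<bullet> f t - \<phi> t) has_real_derivative D) (at t))"
    using der
  proof eventually_elim
    case (elim t)
    show ?case
    proof (intro impI exI conjI)
      assume t: "t \<in> {a<..<b}"
      with elim have "(f has_vector_derivative vector_derivative f (at t)) (at t)"
        by (simp add: vector_derivative_works)
      then have "((\<lambda>t. w \<bullet> f t) has_real_derivative w \<bullet> vector_derivative f (at t)) (at t)"
        unfolding has_vector_derivative_def has_field_derivative_def
        by (auto intro!: derivative_eq_intros simp: mult.commute)
      then show "((\<lambda>t. w \<bullet> f t - \<phi> t) has_real_derivative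
          w \<bullet> vector_derivative f (at t) - \<phi>' t) (at t)"
        using \<phi>[OF t] by (rule DERIV_diff)
      show "w \<bullet> vector_derivative f (at t) - \<phi>' t \<le> 0"
        using elim t by simp
    qed
  qed
  ultimately have "w \<bullet> f b - \<phi> b \<le> w \<bullet> f a - \<phi> a"
    using abs_continuous_on_nonincreasing \<open>a \<le> b\<close> by blast
  then show ?thesis
    by (simp add: inner_diff_right)
qed

text \<open>Test with the direction \<open>sgn (f b - f a)\<close> of the increment itself: its norm
  is at most 1, and pairing it with the increment returns the norm, also when the increment is
  0.\<close>

lemma abs_continuous_on_norm_increment_le:
  fixes f :: "real \<Rightarrow> 'a::real_inner"
  assumes ac: "abs_continuous_on a b f" and "a \<le> b"
    and lip: "C-lipschitz_on {a..b} \<phi>"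
    and \<phi>: "\<And>t. t \<in> {a<..<b} \<Longrightarrow> (\<phi> has_real_derivative \<phi>' t) (at t)"
    and der: "AE t in lebesgue. t \<in> {a<..<b} \<longrightarrow>
      f differentiable (at t) \<and> norm (vector_derivative f (at t)) \<le> \<phi>' t"
  shows "norm (f b - f a) \<le> \<phi> b - \<phi> a"
proof -
  define w where "w = sgn (f b - f a)"
  have "norm w \<le> 1"
    by (simp add: w_def norm_sgn)
  have "w \<bullet> (f b - f a) \<le> \<phi> b - \<phi> a"
  proof (rule abs_continuous_on_inner_increment_le[OF ac \<open>a \<le> b\<close> lip \<phi>])
    show "AE t in lebesgue. t \<in> {a<..<b} \<longrightarrow>
        f differentiable (at t) \<and> w \<bullet> vector_derivative f (at t) \<le> \<phi>' t"
      using der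
    proof eventually_elim
      case (elim t)
      have "w \<bullet> vector_derivative f (at t) \<le> norm w * norm (vector_derivative f (at t))"
        by (rule norm_cauchy_schwarz)
      also have "\<dots> \<le> norm (vector_derivative f (at t))"
        using \<open>norm w \<le> 1\<close> by (simp add: mult_left_le_one_le)
      finally show ?case
        using elim by auto
    qed
  qed
  moreover have "w \<bullet> (f b - f a) = norm (f b - f a)"
    by (cases "f b = f a") (simp_all add: w_def sgn_div_norm dot_square_norm power2_eq_square)
  ultimately show ?thesis
    by simp
qed

text \<open>If the average slope were outside \<open>C\<close>, a hyperplane would separate it
  strictly from \<open>C\<close>. The derivative lies a.e. on the side of \<open>C\<close>, so the
  average slope cannot lie strictly on the other side. The signs of \<open>w\<close> and
  \<open>c\<close> are flipped to turn this lower bound into an upper one.\<close>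

lemma abs_continuous_on_difference_quotient_mem:
  fixes f :: "real \<Rightarrow> 'a::euclidean_space"
  assumes ac: "abs_continuous_on a b f" and "a < b"
    and C: "closed C" "convex C"
    and der: "AE t in lebesgue. t \<in> {a<..<b} \<longrightarrow>
      f differentiable (at t) \<and> vector_derivative f (at t) \<in> C"
  shows "(f b - f a) /\<^sub>R (b - a) \<in> C"
proof (rule ccontr)
  assume "(f b - f a) /\<^sub>R (b - a) \<notin> C"
  then obtain w c where c: "w \<bullet> ((f b - f a) /\<^sub>R (b - a)) < c" "\<And>x. x \<in> C \<Longrightarrow> c < w \<bullet> x"
    using separating_hyperplane_closed_point[OF C(2,1)] by blast
  have "(- w) \<bullet> (f b - f a) \<le> (- c) * b - (- c) * a"
  proof (rule abs_continuous_on_inner_increment_le[OF ac])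
    show "\<bar>- c\<bar>-lipschitz_on {a..b} (\<lambda>t. (- c) * t)"
      using lipschitz_on_cmult_real[OF lipschitz_on_id[of "{a..b}"], of "- c"] by simp
    show "((\<lambda>t. (- c) * t) has_real_derivative - c) (at t)" for t
      by (auto intro!: derivative_eq_intros)
    show "AE t in lebesgue. t \<in> {a<..<b} \<longrightarrow>
        f differentiable (at t) \<and> (- w) \<bullet> vector_derivative f (at t) \<le> - c"
      using der by eventually_elim (use c(2) in \<open>force simp: less_imp_le\<close>)
  qed (use \<open>a < b\<close> in simp)
  moreover have "w \<bullet> (f b - f a) / (b - a) < c"
    using c(1) by (simp only: inner_scaleR_right divide_inverse mult.commute)
  ultimately show False
    using \<open>a < b\<close> by (simp add: pos_divide_less_eq right_diff_distrib)
qed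

section \<open>Gronwall's inequality\<close>

text \<open>
  At a maximum point \<open>s\<close> of \<open>\<psi>\<close>, with \<open>k = \<psi> s\<close>, the speed on \<open>[0,s]\<close> is at most
  \<open>L k exp (L t) - 1\<close>. Integrating up to \<open>s\<close> gives \<open>k exp (L s) \<le> k exp (L s) - k + c\<close>, so
  \<open>k \<le> c\<close>.
\<close>

lemma abs_continuous_on_gronwall:
  fixes x :: "real \<Rightarrow> 'a::real_inner"
  assumes ac: "abs_continuous_on 0 \<tau> x" and "L > 0"
    and der: "AE t in lebesgue. t \<in> {0<..<\<tau>} \<longrightarrow> x differentiable (at t) \<and>
      norm (vector_derivative x (at t)) \<le> M + L * t + L * norm (x t - x 0)"
    and t: "t \<in> {0..\<tau>}"
  shows "norm (x t - x 0) + t + (M + 1) / L \<le> (M + 1) / L * exp (L * t)"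
proof -
  \<comment> \<open>With this \<open>c\<close> the speed bound
    \<open>M + L * t + L * norm (x t - x 0)\<close> becomes
    \<open>L * (norm (x t - x 0) + t + c) - 1\<close>, and the claim becomes
    \<open>\<psi> t \<le> c\<close>.\<close>
  define c where "c = (M + 1) / L"
  then have Lc: "L * c = M + 1"
    using \<open>L > 0\<close> by simp
  define \<psi> where "\<psi> t = (norm (x t - x 0) + t + c) * exp (- L * t)" for t
  have "continuous_on {0..\<tau>} \<psi>"
    unfolding \<psi>_def using abs_continuous_on_imp_continuous_on[OF ac]
    by (intro continuous_intros)
  then obtain s where s: "s \<in> {0..\<tau>}" "\<And>t. t \<in> {0..\<tau>} \<Longrightarrow> \<psi> t \<le> \<psi> s"
    using continuous_attains_sup[of "{0..\<tau>}" \<psi>] t by auto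
  have \<psi>_exp: "norm (x t - x 0) + t + c = \<psi> t * exp (L * t)" for t
    by (simp add: \<psi>_def flip: exp_add)
  define k where "k = \<psi> s"
  \<comment> \<open>An antiderivative of the speed bound
    \<open>L * k * exp (L * t) - 1\<close>.\<close>
  define \<phi> where "\<phi> t = k * exp (L * t) - t" for t
  define \<phi>' where "\<phi>' t = k * (L * exp (L * t)) - 1" for t
  have \<phi>: "(\<phi> has_real_derivative \<phi>' t) (at t)" for t
    unfolding \<phi>_def \<phi>'_def by (auto intro!: derivative_eq_intros)
  have "continuous_on {0..s} \<phi>'"
    unfolding \<phi>'_def by (intro continuous_intros)
  then obtain C where C: "\<And>t. t \<in> {0..s} \<Longrightarrow> \<bar>\<phi>' t\<bar> \<le> C"
    using compact_imp_bounded[OF compact_continuous_image, of "{0..s}" \<phi>']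
    by (auto simp: bounded_iff simp del: atLeastAtMost_iff)
  have "C \<ge> 0"
    using C[of 0] s(1) by force
  have lip: "C-lipschitz_on {0..s} \<phi>"
  proof (rule lipschitz_onI)
    fix u v assume "u \<in> {0..s}" "v \<in> {0..s}"
    then show "dist (\<phi> u) (\<phi> v) \<le> C * dist u v"
      unfolding dist_norm using C \<phi>
      by (intro field_differentiable_bound[where S = "{0..s}" and f' = \<phi>'])
         (auto intro: has_field_derivative_at_within)
  qed fact
  have "norm (x s - x 0) \<le> \<phi> s - \<phi> 0"
  proof (rule abs_continuous_on_norm_increment_le[OF _ _ lip \<phi>])
    show "abs_continuous_on 0 s x"
      using ac by (rule abs_continuous_on_subset) (use s in auto)
    show "AE t in lebesgue. t \<in> {0<..<s} \<longrightarrow>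
        x differentiable (at t) \<and> norm (vector_derivative x (at t)) \<le> \<phi>' t"
      using der
    proof eventually_elim
      case (elim t)
      show ?case
      proof
        assume t: "t \<in> {0<..<s}"
        have "M + L * t + L * norm (x t - x 0) = L * (norm (x t - x 0) + t + c) - 1"
          using Lc by (simp add: distrib_left)
        also have "\<dots> = L * (\<psi> t * exp (L * t)) - 1"
          by (simp only: \<psi>_exp)
        also have "\<dots> \<le> L * (k * exp (L * t)) - 1"
          using s t \<open>L > 0\<close> by (simp add: k_def)
        finally show "x differentiable (at t) \<and> norm (vector_derivative x (at t)) \<le> \<phi>' t"
          using elim t s(1) by (auto simp: \<phi>'_def mult.left_commute)
      qed
    qed
  qed (use s in simp)
  then have "k \<le> c"
    using \<psi>_exp[of s] by (simp add: \<phi>_def k_def)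
  then show ?thesis
    using s(2)[OF t] \<psi>_exp[of t] by (simp add: k_def c_def[symmetric])
qed

section \<open>One-sided distances and the constants of the scheme\<close>

text \<open>On a nonempty compact set the infimum in \<open>point_dist\<close> is attained, so an
  extended-real bound becomes a real bound realised by an actual point.\<close>

lemma excess_leE:
  fixes A B :: "'a::{real_normed_vector, heine_borel} set"
  assumes "excess A B \<le> ennreal d" "d \<ge> 0" "v \<in> A" "compact B" "B \<noteq> {}"
  obtains b where "b \<in> B" "norm (v - b) \<le> d"
proof -
  obtain b where b: "b \<in> B" "\<And>y. y \<in> B \<Longrightarrow> dist v b \<le> dist v y"
    using distance_attains_inf[OF compact_imp_closed[OF \<open>compact B\<close>] \<open>B \<noteq> {}\<close>] by blast
  have "ennreal (norm (v - b)) \<le> point_dist v B"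
    unfolding point_dist_def using b(2) by (auto intro!: INF_greatest simp: dist_norm ennreal_leI)
  also have "\<dots> \<le> excess A B"
    unfolding excess_def using \<open>v \<in> A\<close> by (rule SUP_upper)
  also have "\<dots> \<le> ennreal d"
    by fact
  finally show ?thesis
    using b(1) \<open>d \<ge> 0\<close> that by simp
qed

lemma point_dist_mem: "a \<in> B \<Longrightarrow> point_dist a B = 0"
  using INF_lower[of a B "\<lambda>b. ennreal (norm (a - b))"] by (simp add: point_dist_def)

text \<open>A supremum of reals bounds its members only once boundedness is known. Every
  \<open>F 0 y\<close> lies within \<open>L * norm (y - x)\<close> of the bounded set
  \<open>F 0 x\<close>, so the inner suprema are uniformly bounded over the bounded set
  \<open>X0\<close>.\<close>

lemma norm_le_init_speed:
  fixes F :: "real \<Rightarrow> 'a::euclidean_space \<Rightarrow> 'a set"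
  assumes X0: "bounded X0" and F: "\<And>x. compact (F 0 x)" "\<And>x. F 0 x \<noteq> {}"
    and lip: "\<And>x y. excess (F 0 x) (F 0 y) \<le> ennreal (L * norm (x - y))" and "L \<ge> 0"
    and x: "x \<in> X0" and v: "v \<in> F 0 x"
  shows "norm v \<le> init_speed F X0"
proof -
  have bdd: "bdd_above (norm ` F 0 y)" for y
    using compact_imp_bounded[OF F(1)] by (auto simp: bounded_iff bdd_above_def)
  obtain C where C: "\<And>b. b \<in> F 0 x \<Longrightarrow> norm b \<le> C"
    using compact_imp_bounded[OF F(1)[of x]] by (auto simp: bounded_iff)
  obtain B where B: "\<And>y. y \<in> X0 \<Longrightarrow> norm (y - x) \<le> B"
    using X0 by (metis bounded_any_center dist_commute dist_norm)
  have "(SUP w\<in>F 0 y. norm w) \<le> C + L * B" if "y \<in> X0" for y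
  proof (rule cSUP_least[OF F(2)])
    fix w assume "w \<in> F 0 y"
    then obtain b where b: "b \<in> F 0 x" "norm (w - b) \<le> L * norm (y - x)"
      using excess_leE[OF lip[of y x] _ _ F] \<open>L \<ge> 0\<close> by (metis mult_nonneg_nonneg norm_ge_zero)
    have "norm w \<le> norm b + norm (w - b)"
      by (rule norm_triangle_sub)
    also have "\<dots> \<le> C + L * B"
      using C[OF b(1)] b(2) mult_left_mono[OF B[OF that] \<open>L \<ge> 0\<close>] by simp
    finally show "norm w \<le> C + L * B" .
  qed
  then have "bdd_above ((\<lambda>y. SUP w\<in>F 0 y. norm w) ` X0)"
    by (auto simp: bdd_above_def)
  then have "(SUP w\<in>F 0 x. norm w) \<le> init_speed F X0"
    unfolding init_speed_def using x by (intro cSUP_upper)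
  then show ?thesis
    using cSUP_upper[OF v bdd] by simp
qed

text \<open>The left side is the constant that Gronwall's inequality produces. The factor
  \<open>max 1 (1 / L)\<close> absorbs \<open>1 / L\<close>, and the supremum in
  \<open>R_const\<close> is nonnegative because its term at \<open>N = 1\<close> is.\<close>

lemma R_const_ge:
  assumes "L > 0" "T > 0"
    and nonneg: "\<And>N. N \<ge> 1 \<Longrightarrow> \<beta> N \<ge> 0"
    and bdd: "bdd_above ((\<lambda>N. \<beta> N / (L * step_size T N)) ` {1..})"
    and "init_speed F X0 \<ge> 0"
  shows "(init_speed F X0 + 1) / L * exp (L * T) \<le> R_const T L F X0 \<beta> (\<lambda>N. 0)"
proof -
  define S where "S = (SUP N\<in>{1..}. \<beta> N / (L * step_size T N))"
  have "0 \<le> \<beta> 1 / (L * step_size T 1)"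
    using nonneg[of 1] \<open>L > 0\<close> \<open>T > 0\<close> by (simp add: step_size_def)
  also have "\<dots> \<le> S"
    unfolding S_def using bdd by (intro cSUP_upper) auto
  finally have "S \<ge> 0" .
  have "(init_speed F X0 + 1) / L * exp (L * T) = 1 / L * exp (L * T) * (init_speed F X0 + 1)"
    by simp
  also have "\<dots> \<le> max 1 (1 / L) * exp (L * T) * (init_speed F X0 + S + 1)"
    using \<open>S \<ge> 0\<close> \<open>L > 0\<close> assms(5) by (intro mult_mono) auto
  finally show ?thesis
    by (simp add: R_const_def S_def)
qed

text \<open>Supplies the two properties of the target set used by the average slope
  argument.\<close>

lemma closed_convex_thickening:
  fixes G :: "'a::euclidean_space set"
  assumes "compact G" "convex G"
  shows "closed {v + b | v b. v \<in> G \<and> b \<in> cball 0 d}" "convex {v + b | v b. v \<in> G \<and> b \<in> cball 0 d}"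
proof -
  show "closed {v + b | v b. v \<in> G \<and> b \<in> cball 0 d}"
    using compact_sums[OF assms(1) compact_cball] by (rule compact_imp_closed)
  have "{v + b | v b. v \<in> G \<and> b \<in> cball 0 d} = (\<Union>v\<in>G. \<Union>b\<in>cball 0 d. {v + b})"
    by blast
  then show "convex {v + b | v b. v \<in> G \<and> b \<in> cball 0 d}"
    using convex_sums[OF assms(2) convex_cball] by simp
qed

lemma grid_Suc: "grid T N (Suc n) = grid T N n + step_size T N"
  by (simp add: grid_def algebra_simps)

lemma grid_mem_Icc:
  assumes "T > 0" "\<tau> > 0" "N \<ge> 1" "n \<le> nat \<lfloor>\<tau> / step_size T N\<rfloor>"
  shows "grid T N n \<in> {0..\<tau>}"
proof -
  have h: "step_size T N > 0"
    using assms by (simp add: step_size_def)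
  have "real n \<le> \<tau> / step_size T N"
    using of_nat_floor[of "\<tau> / step_size T N"] of_nat_mono[OF assms(4)] \<open>\<tau> > 0\<close> h
    by (metis divide_nonneg_pos less_imp_le order_trans)
  then show ?thesis
    using h by (simp add: grid_def pos_le_divide_eq)
qed

lemma max_time_le:
  assumes "\<exists>\<tau>\<in>{0<..T}. sols_constrained F A X0 \<tau> \<noteq> {}"
  shows "max_time T F A X0 \<le> T"
  unfolding max_time_def using assms by (intro cSup_least) auto

section \<open>Exact trajectories on the grid solve the inflated scheme\<close>

theorem proposition6:
  fixes T L R P :: real
    and F :: "real \<Rightarrow> real ^ 'd \<Rightarrow> (real ^ 'd) set"
    and A :: "real \<Rightarrow> (real ^ 'd) set"
    and X0 :: "(real ^ 'd) set"
    and \<beta> :: "nat \<Rightarrow> real"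
  assumes T_pos: "T > 0"
    and L_pos: "L > 0"
    and F_values: "\<And>t x. t \<in> {0..T} \<Longrightarrow> F t x \<noteq> {} \<and> convex (F t x) \<and> compact (F t x)"
    and F_lipschitz: "\<And>t t' x x'. t \<in> {0..T} \<Longrightarrow> t' \<in> {0..T} \<Longrightarrow>
      excess (F t x) (F t' x') \<le> ennreal (L * \<bar>t - t'\<bar> + L * norm (x - x'))"
    and A_closed: "\<And>t. t \<in> {0..T} \<Longrightarrow> closed (A t)"
    and A_closed_graph: "\<And>ts xs t x.
      (\<forall>n::nat. ts n \<in> {0..T} \<and> xs n \<in> A (ts n)) \<Longrightarrow> t \<in> {0..T} \<Longrightarrow>
      ts \<longlonglongrightarrow> t \<Longrightarrow> xs \<longlonglongrightarrow> x \<Longrightarrow> x \<in> A t"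
    and X0_compact: "compact X0"
    and viable: "\<exists>\<tau>\<in>{0<..T}. sols_constrained F A X0 \<tau> \<noteq> {}"
    and \<beta>_nonneg: "\<And>N. N \<ge> 1 \<Longrightarrow> \<beta> N \<ge> 0"
    and \<beta>_eq: "\<And>N. N \<ge> 1 \<Longrightarrow> \<beta> N = L * (P + 1) * (step_size T N)\<^sup>2"
    and R_eq: "R = R_const T L F X0 \<beta> (\<lambda>N. 0)"
    and P_eq: "P = P_const T L F X0 R"
  shows "\<forall>\<tau>\<in>{0<..max_time T F A X0}. \<forall>x\<in>sols_constrained F A X0 \<tau>.
    \<exists>y :: nat \<Rightarrow> nat \<Rightarrow> real ^ 'd. \<forall>N\<ge>1.
      y N \<in> euler_sols T F A X0 N (nat \<lfloor>\<tau> / step_size T N\<rfloor>) (\<beta> N) 0 \<and>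
      (\<forall>n\<le>nat \<lfloor>\<tau> / step_size T N\<rfloor>. x (grid T N n) = y N n)"
proof (intro ballI)
  fix \<tau> x assume \<tau>: "\<tau> \<in> {0<..max_time T F A X0}" and x: "x \<in> sols_constrained F A X0 \<tau>"
  define M where "M = init_speed F X0"
  have "0 < \<tau>" "\<tau> \<le> T"
    using \<tau> max_time_le[OF viable] by auto
  have ac: "abs_continuous_on 0 \<tau> x" and x0: "x 0 \<in> X0" and xA: "\<And>t. t \<in> {0..\<tau>} \<Longrightarrow> x t \<in> A t"
    and incl: "AE t in lebesgue. t \<in> {0<..<\<tau>} \<longrightarrow>
      x differentiable (at t) \<and> vector_derivative x (at t) \<in> F t (x t)"
    using x by (auto simp: sols_constrained_def sols_unconstrained_def)
  have F0: "\<And>y. compact (F 0 y)" "\<And>y. F 0 y \<noteq> {}"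
    "\<And>y z. excess (F 0 y) (F 0 z) \<le> ennreal (L * norm (y - z))"
    using F_values[of 0] F_lipschitz[of 0 0] T_pos by auto
  have init: "norm v \<le> M" if "v \<in> F 0 (x 0)" for v
    unfolding M_def using norm_le_init_speed[where F = F, OF compact_imp_bounded[OF X0_compact] F0 _ x0 that] L_pos
    by simp
  have "M \<ge> 0"
    using F0(2)[of "x 0"] init by (meson all_not_in_conv norm_ge_zero order_trans)
  have near: "\<exists>w\<in>F s z. norm (v - w) \<le> L * \<bar>t - s\<bar> + L * norm (y - z)"
    if "t \<in> {0..T}" "s \<in> {0..T}" "v \<in> F t y" for s t v y z
    using excess_leE[OF F_lipschitz[OF that(1,2)] _ that(3)] F_values[OF that(2)] L_pos
    by (metis abs_ge_zero add_nonneg_nonneg less_imp_le mult_nonneg_nonneg norm_ge_zero)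
  \<comment> \<open>Velocities are compared with \<open>F 0 (x 0)\<close>, where
    \<open>init_speed\<close> gives a bound since \<open>x 0\<close> lies in \<open>X0\<close>. The
    result has the form that Gronwall's inequality takes as input.\<close>
  have speed: "norm v \<le> M + L * t + L * norm (x t - x 0)" if t: "t \<in> {0..T}" and v: "v \<in> F t (x t)" for t v
  proof -
    obtain w where w: "w \<in> F 0 (x 0)" "norm (v - w) \<le> L * \<bar>t - 0\<bar> + L * norm (x t - x 0)"
      using near[OF t _ v, of 0] T_pos by force
    then show ?thesis
      using init[OF w(1)] norm_triangle_sub[of v w] t by simp
  qed
  \<comment> \<open>For the given \<open>P\<close> the quotient is
    \<open>(P + 1) * step_size T N\<close>, so it is bounded although \<open>\<beta>\<close>,
    \<open>R\<close> and \<open>P\<close> refer to each other. The absolute value appears because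
    the sign of \<open>P\<close> is established only later.\<close>
  have "(\<lambda>N. \<beta> N / (L * step_size T N)) N \<le> \<bar>P + 1\<bar> * T" if "N \<in> {1..}" for N
  proof -
    have "\<beta> N / (L * step_size T N) = (P + 1) * step_size T N"
      using that \<beta>_eq[of N] L_pos T_pos by (simp add: step_size_def power2_eq_square)
    also have "\<dots> \<le> \<bar>P + 1\<bar> * T"
      using that T_pos by (intro mult_mono) (auto simp: step_size_def pos_divide_le_eq)
    finally show ?thesis .
  qed
  then have "bdd_above ((\<lambda>N. \<beta> N / (L * step_size T N)) ` {1..})"
    by (rule bdd_aboveI2)
  from R_const_ge[OF L_pos T_pos \<beta>_nonneg this, of F X0] \<open>M \<ge> 0\<close>
  have R: "(M + 1) / L * exp (L * T) \<le> R"
    by (simp add: R_eq M_def)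
  have P: "P = M + L * T + L * R"
    by (simp add: P_eq P_const_def M_def algebra_simps)
  have growth: "norm (x t - x 0) \<le> R" if t: "t \<in> {0..\<tau>}" for t
  proof -
    have "norm (x t - x 0) + t + (M + 1) / L \<le> (M + 1) / L * exp (L * t)"
    proof (rule abs_continuous_on_gronwall[OF ac L_pos _ t])
      show "AE t in lebesgue. t \<in> {0<..<\<tau>} \<longrightarrow> x differentiable (at t) \<and>
          norm (vector_derivative x (at t)) \<le> M + L * t + L * norm (x t - x 0)"
        using incl by eventually_elim (use speed \<open>\<tau> \<le> T\<close> in auto)
    qed
    also have "\<dots> \<le> (M + 1) / L * exp (L * T)"
      using t \<open>\<tau> \<le> T\<close> \<open>M \<ge> 0\<close> L_pos by (intro mult_left_mono) auto
    finally have "norm (x t - x 0) + (t + (M + 1) / L) \<le> R"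
      using R by simp
    moreover have "t + (M + 1) / L \<ge> 0"
      using t \<open>M \<ge> 0\<close> L_pos by simp
    ultimately show ?thesis
      by simp
  qed
  \<comment> \<open>At time 0 the growth bound reads \<open>0 \<le> R\<close>.\<close>
  have "P \<ge> 0"
    using growth[of 0] \<open>0 < \<tau>\<close> T_pos L_pos \<open>M \<ge> 0\<close> by (simp add: P)
  have speed_P: "norm v \<le> P" if "t \<in> {0..\<tau>}" "v \<in> F t (x t)" for t v
  proof -
    have "L * t \<le> L * T" "L * norm (x t - x 0) \<le> L * R"
      using growth[OF that(1)] that(1) \<open>\<tau> \<le> T\<close> L_pos by simp_all
    then show ?thesis
      using speed[of t v] that \<open>\<tau> \<le> T\<close> by (simp add: P)
  qed
  have x_lipschitz: "norm (x t - x s) \<le> P * (t - s)" if "0 \<le> s" "s \<le> t" "t \<le> \<tau>" for s t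
  proof -
    have "norm (x t - x s) \<le> P * t - P * s"
    proof (rule abs_continuous_on_norm_increment_le)
      show "abs_continuous_on s t x"
        using ac by (rule abs_continuous_on_subset) (use that in auto)
      show "\<bar>P\<bar>-lipschitz_on {s..t} (\<lambda>r. P * r)"
        using lipschitz_on_cmult_real[OF lipschitz_on_id[of "{s..t}"], of P] by simp
      show "((\<lambda>r. P * r) has_real_derivative P) (at r)" for r
        by (auto intro!: derivative_eq_intros)
      show "AE r in lebesgue. r \<in> {s<..<t} \<longrightarrow>
          x differentiable (at r) \<and> norm (vector_derivative x (at r)) \<le> P"
        using incl
      proof eventually_elim
        case (elim r)
        then show ?case
          using speed_P[of r] that by auto
      qed
    qed fact
    then show ?thesis
      by (simp add: right_diff_distrib)
  qed
  have step: "x (s + h) \<in> {x s + h *\<^sub>R v + b | v b. v \<in> F s (x s) \<and> b \<in> cball 0 (L * (P + 1) * h\<^sup>2)}"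
    if "0 \<le> s" "0 < h" "s + h \<le> \<tau>" for s h
  proof -
    \<comment> \<open>Over a step of length \<open>h\<close>, time moves by at most \<open>h\<close>
      and the state by at most \<open>P * h\<close>, so \<open>F\<close> moves by at most
      \<open>L * (P + 1) * h\<close>. Multiplying the slope by \<open>h\<close> turns this radius
      into the quadratic blowup.\<close>
    define C where "C = {v + b | v b. v \<in> F s (x s) \<and> b \<in> cball 0 (L * (P + 1) * h)}"
    have sT: "s \<in> {0..T}"
      using that \<open>\<tau> \<le> T\<close> by auto
    have "(x (s + h) - x s) /\<^sub>R (s + h - s) \<in> C"
    proof (rule abs_continuous_on_difference_quotient_mem)
      show "abs_continuous_on s (s + h) x"
        using ac by (rule abs_continuous_on_subset) (use that in auto)
      show "closed C" "convex C"
        unfolding C_def using closed_convex_thickening F_values[OF sT] by blast+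
      show "AE t in lebesgue. t \<in> {s<..<s + h} \<longrightarrow>
          x differentiable (at t) \<and> vector_derivative x (at t) \<in> C"
        using incl
      proof eventually_elim
        case (elim t)
        have "vector_derivative x (at t) \<in> C"
          if t: "t \<in> {s<..<s + h}" and v: "vector_derivative x (at t) \<in> F t (x t)"
        proof -
          have "t \<in> {0..T}"
            using t \<open>0 \<le> s\<close> \<open>s + h \<le> \<tau>\<close> \<open>\<tau> \<le> T\<close> by auto
          from near[OF this sT v] obtain w where w: "w \<in> F s (x s)"
            "norm (vector_derivative x (at t) - w) \<le> L * \<bar>t - s\<bar> + L * norm (x t - x s)"
            by blast
          have "\<bar>t - s\<bar> + norm (x t - x s) \<le> (t - s) + P * (t - s)"
            using x_lipschitz[of s t] t \<open>0 \<le> s\<close> \<open>s + h \<le> \<tau>\<close> by simp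
          also have "\<dots> = (P + 1) * (t - s)"
            by (simp add: algebra_simps)
          also have "\<dots> \<le> (P + 1) * h"
            using t \<open>P \<ge> 0\<close> by (intro mult_left_mono) auto
          finally have "L * (\<bar>t - s\<bar> + norm (x t - x s)) \<le> L * ((P + 1) * h)"
            using L_pos by simp
          then have "norm (vector_derivative x (at t) - w) \<le> L * (P + 1) * h"
            using w(2) by (simp add: algebra_simps)
          then show ?thesis
            unfolding C_def using w(1)
            by (intro CollectI exI[of _ w] exI[of _ "vector_derivative x (at t) - w"]) simp
        qed
        then show ?case
          using elim \<open>0 \<le> s\<close> \<open>s + h \<le> \<tau>\<close> by auto
      qed
    qed (use \<open>0 < h\<close> in simp)
    then obtain v b where vb: "v \<in> F s (x s)" "norm b \<le> L * (P + 1) * h"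
        "(x (s + h) - x s) /\<^sub>R h = v + b"
      by (auto simp: C_def)
    from arg_cong[OF vb(3), of "\<lambda>z. h *\<^sub>R z"] have "x (s + h) - x s = h *\<^sub>R (v + b)"
      using \<open>0 < h\<close> by simp
    then have "x (s + h) = x s + h *\<^sub>R v + h *\<^sub>R b"
      by (simp add: algebra_simps)
    moreover have "norm (h *\<^sub>R b) \<le> L * (P + 1) * h\<^sup>2"
      using vb(2) \<open>0 < h\<close> mult_left_mono[OF vb(2), of h] by (simp add: power2_eq_square mult.assoc mult.left_commute)
    ultimately show ?thesis
      using vb(1) by (intro CollectI exI[of _ v] exI[of _ "h *\<^sub>R b"]) simp
  qed
  have "(\<lambda>n. x (grid T N n)) \<in> euler_sols T F A X0 N (nat \<lfloor>\<tau> / step_size T N\<rfloor>) (\<beta> N) 0"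
    if "N \<ge> 1" for N
  proof -
    have h: "step_size T N > 0"
      using that T_pos by (simp add: step_size_def)
    note grid = grid_mem_Icc[OF T_pos \<open>0 < \<tau>\<close> that]
    \<comment> \<open>An index strictly below the floor has its successor's grid point still in
      \<open>{0..\<tau>}\<close>, which is the condition \<open>s + h \<le> \<tau>\<close> of
      \<open>step\<close>.\<close>
    have "x (grid T N (Suc n)) \<in> {x (grid T N n) + step_size T N *\<^sub>R v + b | v b.
        v \<in> F (grid T N n) (x (grid T N n)) \<and> b \<in> cball 0 (\<beta> N)}"
      if "n < nat \<lfloor>\<tau> / step_size T N\<rfloor>" for n
      using step[of "grid T N n" "step_size T N"] grid[of n] grid[of "Suc n"] that h \<beta>_eq[OF \<open>N \<ge> 1\<close>]
      by (simp add: grid_Suc)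
    moreover have "point_dist (x (grid T N 0)) X0 \<le> ennreal 0"
      using x0 by (simp add: grid_def point_dist_mem)
    moreover have "point_dist (x (grid T N n)) (A (grid T N n)) \<le> ennreal 0"
      if "n \<le> nat \<lfloor>\<tau> / step_size T N\<rfloor>" for n
      using xA[OF grid[OF that]] by (simp add: point_dist_mem)
    ultimately show ?thesis
      by (simp add: euler_sols_def)
  qed
  then show "\<exists>y :: nat \<Rightarrow> nat \<Rightarrow> real ^ 'd. \<forall>N\<ge>1.
      y N \<in> euler_sols T F A X0 N (nat \<lfloor>\<tau> / step_size T N\<rfloor>) (\<beta> N) 0 \<and>
      (\<forall>n\<le>nat \<lfloor>\<tau> / step_size T N\<rfloor>. x (grid T N n) = y N n)"
    by (intro exI[of _ "\<lambda>N n. x (grid T N n)"]) simp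
qed

end
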